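(* Let $(A,\mu,\alpha,\beta)$ be a BiHom-alternative algebra and let $\alpha',\beta':A\to A$ be two algebra homomorphisms (linear maps preserving $\mu$) such that any two of the maps $\alpha,\beta,\alpha',\beta'$ commute. Then $$A_{\alpha',\beta'}=(A,\ \mu_{\alpha',\beta'}:=\mu\circ(\alpha'\otimes\beta'),\ \alpha\circ\alpha',\ \beta\circ\beta')$$ is a BiHom-alternative algebra. Moreover, suppose that $(B,\mu',\gamma,\delta)$ is another BiHom-alternative algebra and $\gamma',\delta'$ are algebra endomorphisms of $B$ such that any two of the maps $\gamma,\delta,\gamma',\delta'$ commute, and let $B_{\gamma',\delta'}=(B,\mu'\circ(\gamma'\otimes\delta'),\gamma\circ\gamma',\delta\circ\delta')$. If $f:(A,\mu,\alpha,\beta)\to(B,\mu',\gamma,\delta)$ is a morphism of BiHom-algebras such that $f\circ\alpha'=\gamma'\circ f$ and $f\circ\beta'=\delta'\circ f$, then $f:A_{\alpha',\beta'}\to B_{\gamma',\delta'}$ is also a morphism of BiHom-algebras.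
   Context: $\mathbb{K}$ is an algebraically closed field of characteristic $0$; all vector spaces and (multi)linear maps are over $\mathbb{K}$. A BiHom-algebra $(A,\mu,\alpha,\beta)$ is a vector space $A$ with a bilinear map $\mu:A\times A\to A$ and linear maps $\alpha,\beta:A\to A$ with $\alpha\beta=\beta\alpha$. It is multiplicative if $\alpha(\mu(x,y))=\mu(\alpha(x),\alpha(y))$ and $\beta(\mu(x,y))=\mu(\beta(x),\beta(y))$ for all $x,y\in A$. Its BiHom-associator is $as_{\alpha,\beta}(x,y,z)=\mu(\mu(x,y),\beta(z))-\mu(\alpha(x),\mu(y,z))$. A BiHom-alternative algebra is a multiplicative BiHom-algebra satisfying, for all $x,y,z\in A$, $as_{\alpha,\beta}(\beta(x),\alpha(y),z)+as_{\alpha,\beta}(\beta(y),\alpha(x),z)=0$ and $as_{\alpha,\beta}(x,\beta(y),\alpha(z))+as_{\alpha,\beta}(x,\beta(z),\alpha(y))=0$. A morphism of BiHom-algebras $f:(A,\mu,\alpha,\beta)\to(B,\mu',\gamma,\delta)$ is a linear map with $f\circ\mu=\mu'\circ(f\otimes f)$, $f\circ\alpha=\gamma\circ f$ and $f\circ\beta=\delta\circ f$. *)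

theory Defs
  imports "HOL-Computational_Algebra.Polynomial"
begin

text \<open>
  \<open>Vector_Spaces.linear\<close> is written with its qualifier because the bare name \<open>linear\<close>
  denotes linearity over the reals.
\<close>

locale bihom_algebra = vector_space scale
  for scale :: "'k::field \<Rightarrow> 'a::ab_group_add \<Rightarrow> 'a" +
  fixes \<mu> :: "'a \<Rightarrow> 'a \<Rightarrow> 'a"
    and \<alpha> :: "'a \<Rightarrow> 'a"
    and \<beta> :: "'a \<Rightarrow> 'a"
  assumes mult_linear_left: "\<And>y. Vector_Spaces.linear scale scale (\<lambda>x. \<mu> x y)"
    and mult_linear_right: "\<And>x. Vector_Spaces.linear scale scale (\<lambda>y. \<mu> x y)"
    and alpha_linear: "Vector_Spaces.linear scale scale \<alpha>"
    and beta_linear: "Vector_Spaces.linear scale scale \<beta>"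
    and alpha_beta_commute: "\<alpha> \<circ> \<beta> = \<beta> \<circ> \<alpha>"

locale multiplicative_bihom_algebra = bihom_algebra +
  assumes alpha_mult: "\<And>x y. \<alpha> (\<mu> x y) = \<mu> (\<alpha> x) (\<alpha> y)"
    and beta_mult: "\<And>x y. \<beta> (\<mu> x y) = \<mu> (\<beta> x) (\<beta> y)"

definition bihom_associator ::
  "('a \<Rightarrow> 'a \<Rightarrow> 'a) \<Rightarrow> ('a \<Rightarrow> 'a) \<Rightarrow> ('a \<Rightarrow> 'a) \<Rightarrow> 'a \<Rightarrow> 'a \<Rightarrow> 'a \<Rightarrow> 'a::ab_group_add"
  where "bihom_associator \<mu> \<alpha> \<beta> x y z = \<mu> (\<mu> x y) (\<beta> z) - \<mu> (\<alpha> x) (\<mu> y z)"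

locale bihom_alternative_algebra = multiplicative_bihom_algebra +
  assumes left_alternative: "\<And>x y z.
      bihom_associator \<mu> \<alpha> \<beta> (\<beta> x) (\<alpha> y) z + bihom_associator \<mu> \<alpha> \<beta> (\<beta> y) (\<alpha> x) z = 0"
    and right_alternative: "\<And>x y z.
      bihom_associator \<mu> \<alpha> \<beta> x (\<beta> y) (\<alpha> z) + bihom_associator \<mu> \<alpha> \<beta> x (\<beta> z) (\<alpha> y) = 0"

locale bihom_morphism =
  source: bihom_algebra scaleA \<mu> \<alpha> \<beta> + target: bihom_algebra scaleB \<mu>' \<gamma> \<delta>
  for scaleA :: "'k::field \<Rightarrow> 'a::ab_group_add \<Rightarrow> 'a" and \<mu> \<alpha> \<beta>
    and scaleB :: "'k \<Rightarrow> 'b::ab_group_add \<Rightarrow> 'b" and \<mu>' \<gamma> \<delta> +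
  fixes f :: "'a \<Rightarrow> 'b"
  assumes morphism_linear: "Vector_Spaces.linear scaleA scaleB f"
    and morphism_mult: "\<And>x y. f (\<mu> x y) = \<mu>' (f x) (f y)"
    and morphism_alpha: "f \<circ> \<alpha> = \<gamma> \<circ> f"
    and morphism_beta: "f \<circ> \<beta> = \<delta> \<circ> f"

definition algebra_endomorphism ::
  "('k::field \<Rightarrow> 'a::ab_group_add \<Rightarrow> 'a) \<Rightarrow> ('a \<Rightarrow> 'a \<Rightarrow> 'a) \<Rightarrow> ('a \<Rightarrow> 'a) \<Rightarrow> bool"
  where "algebra_endomorphism scale \<mu> \<phi> \<longleftrightarrow>
    Vector_Spaces.linear scale scale \<phi> \<and> (\<forall>x y. \<phi> (\<mu> x y) = \<mu> (\<phi> x) (\<phi> y))"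

definition pairwise_commute :: "('a \<Rightarrow> 'a) set \<Rightarrow> bool"
  where "pairwise_commute F \<longleftrightarrow> (\<forall>\<phi>\<in>F. \<forall>\<psi>\<in>F. \<phi> \<circ> \<psi> = \<psi> \<circ> \<phi>)"

definition twisted_mult ::
  "('a \<Rightarrow> 'a \<Rightarrow> 'a) \<Rightarrow> ('a \<Rightarrow> 'a) \<Rightarrow> ('a \<Rightarrow> 'a) \<Rightarrow> 'a \<Rightarrow> 'a \<Rightarrow> 'a"
  where "twisted_mult \<mu> \<phi> \<psi> x y = \<mu> (\<phi> x) (\<psi> y)"

end

theory Submission
  imports Defs
begin

text \<open>
  Because \<open>\<alpha>'\<close> and \<open>\<beta>'\<close> are multiplicative and commute with \<open>\<alpha>\<close> and \<open>\<beta>\<close>, the twisted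
  associator of \<open>x, y, z\<close> is the original associator of \<open>\<alpha>'\<^sup>2 x, \<alpha>' \<beta>' y, \<beta>'\<^sup>2 z\<close>. Both
  alternative laws of the twist are therefore instances of the original ones: the left law at
  \<open>\<alpha>'\<^sup>2 \<beta>' x, \<alpha>'\<^sup>2 \<beta>' y, \<beta>'\<^sup>2 z\<close> and the right law at
  \<open>\<alpha>'\<^sup>2 x, \<alpha>' \<beta>'\<^sup>2 y, \<alpha>' \<beta>'\<^sup>2 z\<close>.
\<close>

lemma pairwise_commuteD:
  assumes "pairwise_commute F" "\<phi> \<in> F" "\<psi> \<in> F"
  shows "\<phi> (\<psi> x) = \<psi> (\<phi> x)"
proof -
  have "\<phi> \<circ> \<psi> = \<psi> \<circ> \<phi>" using assms by (simp add: pairwise_commute_def)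
  then show ?thesis by (rule comp_eq_dest)
qed

text \<open>The outer \<open>\<phi>\<close> is pushed through a left inner product, the outer
  \<open>\<psi>\<close> through a right one. The middle argument then appears as
  \<open>\<phi> (\<psi> y)\<close> in one term and as \<open>\<psi> (\<phi> y)\<close> in the other,
  and \<open>comm(3)\<close> identifies the two.\<close>

lemma bihom_associator_twisted:
  assumes mult: "\<And>x y. \<phi> (\<mu> x y) = \<mu> (\<phi> x) (\<phi> y)" "\<And>x y. \<psi> (\<mu> x y) = \<mu> (\<psi> x) (\<psi> y)"
    and comm: "\<And>x. \<phi> (\<alpha> x) = \<alpha> (\<phi> x)" "\<And>x. \<psi> (\<beta> x) = \<beta> (\<psi> x)" "\<And>x. \<psi> (\<phi> x) = \<phi> (\<psi> x)"
  shows "bihom_associator (twisted_mult \<mu> \<phi> \<psi>) (\<alpha> \<circ> \<phi>) (\<beta> \<circ> \<psi>) x y z =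
    bihom_associator \<mu> \<alpha> \<beta> (\<phi> (\<phi> x)) (\<phi> (\<psi> y)) (\<psi> (\<psi> z))"
  by (simp add: bihom_associator_def twisted_mult_def mult comm)

lemma bihom_algebra_twisted:
  assumes "bihom_algebra scale \<mu> \<alpha> \<beta>"
    and "Vector_Spaces.linear scale scale \<phi>" "Vector_Spaces.linear scale scale \<psi>"
    and comm: "pairwise_commute {\<alpha>, \<beta>, \<phi>, \<psi>}"
  shows "bihom_algebra scale (twisted_mult \<mu> \<phi> \<psi>) (\<alpha> \<circ> \<phi>) (\<beta> \<circ> \<psi>)"
proof -
  interpret bihom_algebra scale \<mu> \<alpha> \<beta> by fact
  show ?thesis
  proof (rule bihom_algebra.intro[OF vector_space_axioms bihom_algebra_axioms.intro])
    show "Vector_Spaces.linear scale scale (\<lambda>x. twisted_mult \<mu> \<phi> \<psi> x y)" for y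
      \<comment> \<open>With \<open>y\<close> fixed, the twisted product is \<open>\<phi>\<close>
        followed by multiplication by \<open>\<psi> y\<close> on the right; the other slot is
        symmetric.\<close>
      using Vector_Spaces.linear_compose[OF assms(2) mult_linear_left[of "\<psi> y"]]
      by (simp add: twisted_mult_def comp_def)
    show "Vector_Spaces.linear scale scale (\<lambda>y. twisted_mult \<mu> \<phi> \<psi> x y)" for x
      using Vector_Spaces.linear_compose[OF assms(3) mult_linear_right[of "\<phi> x"]]
      by (simp add: twisted_mult_def comp_def)
    show "Vector_Spaces.linear scale scale (\<alpha> \<circ> \<phi>)"
      by (rule Vector_Spaces.linear_compose[OF assms(2) alpha_linear])
    show "Vector_Spaces.linear scale scale (\<beta> \<circ> \<psi>)"
      by (rule Vector_Spaces.linear_compose[OF assms(3) beta_linear])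
    show "(\<alpha> \<circ> \<phi>) \<circ> (\<beta> \<circ> \<psi>) = (\<beta> \<circ> \<psi>) \<circ> (\<alpha> \<circ> \<phi>)"
    proof
      fix x
      note c = pairwise_commuteD[OF comm]
      \<comment> \<open>Four transpositions carry \<open>\<beta>\<close> and \<open>\<psi>\<close>
        in front of \<open>\<alpha>\<close> and \<open>\<phi>\<close>.\<close>
      have "\<alpha> (\<phi> (\<beta> (\<psi> x))) = \<alpha> (\<beta> (\<phi> (\<psi> x)))" by (simp add: c[of \<phi> \<beta>])
      also have "\<dots> = \<beta> (\<alpha> (\<psi> (\<phi> x)))" by (simp add: c[of \<alpha> \<beta>] c[of \<phi> \<psi>])
      also have "\<dots> = \<beta> (\<psi> (\<alpha> (\<phi> x)))" by (simp add: c[of \<alpha> \<psi>])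
      finally show "((\<alpha> \<circ> \<phi>) \<circ> (\<beta> \<circ> \<psi>)) x = ((\<beta> \<circ> \<psi>) \<circ> (\<alpha> \<circ> \<phi>)) x" by simp
    qed
  qed
qed

lemma bihom_alternative_algebra_twisted:
  assumes "bihom_alternative_algebra scale \<mu> \<alpha> \<beta>"
    and endo: "algebra_endomorphism scale \<mu> \<phi>" "algebra_endomorphism scale \<mu> \<psi>"
    and comm: "pairwise_commute {\<alpha>, \<beta>, \<phi>, \<psi>}"
  shows "bihom_alternative_algebra scale (twisted_mult \<mu> \<phi> \<psi>) (\<alpha> \<circ> \<phi>) (\<beta> \<circ> \<psi>)"
proof -
  interpret bihom_alternative_algebra scale \<mu> \<alpha> \<beta> by fact
  have mult: "\<phi> (\<mu> x y) = \<mu> (\<phi> x) (\<phi> y)" "\<psi> (\<mu> x y) = \<mu> (\<psi> x) (\<psi> y)" for x y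
    using endo by (simp_all add: algebra_endomorphism_def)
  \<comment> \<open>The equations are oriented towards a normal form: \<open>\<alpha>\<close> and
    \<open>\<beta>\<close> outermost, then \<open>\<phi>\<close>, with \<open>\<psi>\<close>
    innermost.\<close>
  have c: "\<phi> (\<alpha> x) = \<alpha> (\<phi> x)" "\<phi> (\<beta> x) = \<beta> (\<phi> x)" "\<psi> (\<alpha> x) = \<alpha> (\<psi> x)"
    "\<psi> (\<beta> x) = \<beta> (\<psi> x)" "\<psi> (\<phi> x) = \<phi> (\<psi> x)" for x
    using pairwise_commuteD[OF comm, of \<phi> \<alpha>] pairwise_commuteD[OF comm, of \<phi> \<beta>]
      pairwise_commuteD[OF comm, of \<psi> \<alpha>] pairwise_commuteD[OF comm, of \<psi> \<beta>]
      pairwise_commuteD[OF comm, of \<psi> \<phi>] by simp_all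
  interpret twisted: bihom_algebra scale "twisted_mult \<mu> \<phi> \<psi>" "\<alpha> \<circ> \<phi>" "\<beta> \<circ> \<psi>"
    using bihom_algebra_twisted[OF bihom_algebra_axioms _ _ comm] endo
    by (simp add: algebra_endomorphism_def)
  note assoc = bihom_associator_twisted[of \<phi> \<mu> \<psi> \<alpha> \<beta>, OF mult c(1) c(4) c(5)]
  show ?thesis
  proof
    fix x y z
    show "(\<alpha> \<circ> \<phi>) (twisted_mult \<mu> \<phi> \<psi> x y) = twisted_mult \<mu> \<phi> \<psi> ((\<alpha> \<circ> \<phi>) x) ((\<alpha> \<circ> \<phi>) y)"
      and "(\<beta> \<circ> \<psi>) (twisted_mult \<mu> \<phi> \<psi> x y) = twisted_mult \<mu> \<phi> \<psi> ((\<beta> \<circ> \<psi>) x) ((\<beta> \<circ> \<psi>) y)"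
      by (simp_all add: twisted_mult_def mult c alpha_mult beta_mult)
    let ?as = "bihom_associator (twisted_mult \<mu> \<phi> \<psi>) (\<alpha> \<circ> \<phi>) (\<beta> \<circ> \<psi>)"
    \<comment> \<open>The associator formula puts \<open>\<phi>\<^sup>2\<close> on the first slot
      and \<open>\<phi> \<psi>\<close> on the second. The \<open>\<psi>\<close> of
      \<open>\<beta> \<circ> \<psi>\<close> and the \<open>\<phi>\<close> of
      \<open>\<alpha> \<circ> \<phi>\<close> even this out: both slots carry
      \<open>\<phi>\<^sup>2 \<psi>\<close>, so exchanging \<open>x\<close> and \<open>y\<close> is
      the exchange in the original law.\<close>
    show "?as ((\<beta> \<circ> \<psi>) x) ((\<alpha> \<circ> \<phi>) y) z + ?as ((\<beta> \<circ> \<psi>) y) ((\<alpha> \<circ> \<phi>) x) z = 0"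
      by (simp add: assoc left_alternative c)
    \<comment> \<open>Here the last two slots start with \<open>\<phi> \<psi>\<close> and
      \<open>\<psi>\<^sup>2\<close>, and both end up with
      \<open>\<phi> \<psi>\<^sup>2\<close>.\<close>
    show "?as x ((\<beta> \<circ> \<psi>) y) ((\<alpha> \<circ> \<phi>) z) + ?as x ((\<beta> \<circ> \<psi>) z) ((\<alpha> \<circ> \<phi>) y) = 0"
      by (simp add: assoc right_alternative c)
  qed
qed

text \<open>Since \<open>f\<close> intertwines the twisting maps, twisting before or after
  \<open>f\<close> gives the same product, and likewise for the composed structure maps. The
  assumptions on the twists supply the source and target that \<open>bihom_morphism\<close> bundles
  with \<open>f\<close>.\<close>

lemma bihom_morphism_twisted:
  assumes "bihom_morphism scaleA \<mu> \<alpha> \<beta> scaleB \<mu>' \<gamma> \<delta> f"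
    and "bihom_algebra scaleA (twisted_mult \<mu> \<alpha>' \<beta>') (\<alpha> \<circ> \<alpha>') (\<beta> \<circ> \<beta>')"
    and "bihom_algebra scaleB (twisted_mult \<mu>' \<gamma>' \<delta>') (\<gamma> \<circ> \<gamma>') (\<delta> \<circ> \<delta>')"
    and "f \<circ> \<alpha>' = \<gamma>' \<circ> f" "f \<circ> \<beta>' = \<delta>' \<circ> f"
  shows "bihom_morphism scaleA (twisted_mult \<mu> \<alpha>' \<beta>') (\<alpha> \<circ> \<alpha>') (\<beta> \<circ> \<beta>')
    scaleB (twisted_mult \<mu>' \<gamma>' \<delta>') (\<gamma> \<circ> \<gamma>') (\<delta> \<circ> \<delta>') f"
proof -
  interpret f: bihom_morphism scaleA \<mu> \<alpha> \<beta> scaleB \<mu>' \<gamma> \<delta> f by fact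
  have f_comm: "f (\<alpha> x) = \<gamma> (f x)" "f (\<beta> x) = \<delta> (f x)"
    "f (\<alpha>' x) = \<gamma>' (f x)" "f (\<beta>' x) = \<delta>' (f x)" for x
    using f.morphism_alpha f.morphism_beta assms(4,5) by (auto dest: comp_eq_dest)
  show ?thesis
  proof (rule bihom_morphism.intro)
    show "bihom_morphism_axioms scaleA (twisted_mult \<mu> \<alpha>' \<beta>') (\<alpha> \<circ> \<alpha>') (\<beta> \<circ> \<beta>')
      scaleB (twisted_mult \<mu>' \<gamma>' \<delta>') (\<gamma> \<circ> \<gamma>') (\<delta> \<circ> \<delta>') f"
      by (rule bihom_morphism_axioms.intro)
        (simp_all add: f.morphism_linear twisted_mult_def f.morphism_mult f_comm fun_eq_iff)
  qed fact+
qed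

theorem proposition3p5:
  fixes scaleA :: "'k::{alg_closed_field, field_char_0} \<Rightarrow> 'a::ab_group_add \<Rightarrow> 'a"
    and \<mu> :: "'a \<Rightarrow> 'a \<Rightarrow> 'a"
    and \<alpha> \<beta> \<alpha>' \<beta>' :: "'a \<Rightarrow> 'a"
  assumes "bihom_alternative_algebra scaleA \<mu> \<alpha> \<beta>"
    and "algebra_endomorphism scaleA \<mu> \<alpha>'"
    and "algebra_endomorphism scaleA \<mu> \<beta>'"
    and "pairwise_commute {\<alpha>, \<beta>, \<alpha>', \<beta>'}"
  shows "bihom_alternative_algebra scaleA (twisted_mult \<mu> \<alpha>' \<beta>') (\<alpha> \<circ> \<alpha>') (\<beta> \<circ> \<beta>') \<and>
    (\<forall>(scaleB :: 'k \<Rightarrow> 'b::ab_group_add \<Rightarrow> 'b) \<mu>' \<gamma> \<delta> \<gamma>' \<delta>' (f :: 'a \<Rightarrow> 'b).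
       bihom_alternative_algebra scaleB \<mu>' \<gamma> \<delta> \<longrightarrow>
       algebra_endomorphism scaleB \<mu>' \<gamma>' \<longrightarrow>
       algebra_endomorphism scaleB \<mu>' \<delta>' \<longrightarrow>
       pairwise_commute {\<gamma>, \<delta>, \<gamma>', \<delta>'} \<longrightarrow>
       bihom_morphism scaleA \<mu> \<alpha> \<beta> scaleB \<mu>' \<gamma> \<delta> f \<longrightarrow>
       f \<circ> \<alpha>' = \<gamma>' \<circ> f \<longrightarrow>
       f \<circ> \<beta>' = \<delta>' \<circ> f \<longrightarrow>
       bihom_morphism scaleA (twisted_mult \<mu> \<alpha>' \<beta>') (\<alpha> \<circ> \<alpha>') (\<beta> \<circ> \<beta>')
         scaleB (twisted_mult \<mu>' \<gamma>' \<delta>') (\<gamma> \<circ> \<gamma>') (\<delta> \<circ> \<delta>') f)"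
proof (intro conjI allI impI)
  show twist: "bihom_alternative_algebra scaleA (twisted_mult \<mu> \<alpha>' \<beta>') (\<alpha> \<circ> \<alpha>') (\<beta> \<circ> \<beta>')"
    using assms by (rule bihom_alternative_algebra_twisted)
  \<comment> \<open>Morphisms are defined between plain BiHom-algebras, so the twists are reduced to
    that underlying structure.\<close>
  note forget = multiplicative_bihom_algebra.axioms(1)[OF bihom_alternative_algebra.axioms(1)]
  fix scaleB :: "'k \<Rightarrow> 'b::ab_group_add \<Rightarrow> 'b" and \<mu>' \<gamma> \<delta> \<gamma>' \<delta>' and f :: "'a \<Rightarrow> 'b"
  assume "bihom_alternative_algebra scaleB \<mu>' \<gamma> \<delta>"
    and "algebra_endomorphism scaleB \<mu>' \<gamma>'" "algebra_endomorphism scaleB \<mu>' \<delta>'"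
    and "pairwise_commute {\<gamma>, \<delta>, \<gamma>', \<delta>'}"
  then have twistB:
    "bihom_alternative_algebra scaleB (twisted_mult \<mu>' \<gamma>' \<delta>') (\<gamma> \<circ> \<gamma>') (\<delta> \<circ> \<delta>')"
    by (rule bihom_alternative_algebra_twisted)
  assume "bihom_morphism scaleA \<mu> \<alpha> \<beta> scaleB \<mu>' \<gamma> \<delta> f"
    and "f \<circ> \<alpha>' = \<gamma>' \<circ> f" "f \<circ> \<beta>' = \<delta>' \<circ> f"
  then show "bihom_morphism scaleA (twisted_mult \<mu> \<alpha>' \<beta>') (\<alpha> \<circ> \<alpha>') (\<beta> \<circ> \<beta>')
      scaleB (twisted_mult \<mu>' \<gamma>' \<delta>') (\<gamma> \<circ> \<gamma>') (\<delta> \<circ> \<delta>') f"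
    by (rule bihom_morphism_twisted[OF _ forget[OF twist] forget[OF twistB]])
qed

end
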